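(* Let $L$ be a free quandle and let $Q$ be a subquandle of $L$. Then $Q$ is a free quandle.
   Context: A quandle is a set $Q$ with two binary operations $\triangleleft,\triangleright$ satisfying, for all $a,b,c\in Q$: (1) $a\triangleleft (b\triangleleft c)=(a\triangleleft b)\triangleleft(a\triangleleft c)$; (2) $(a\triangleright b)\triangleright c=(a\triangleright c)\triangleright(b\triangleright c)$; (3) $a\triangleleft(b\triangleright a)=b=(a\triangleleft b)\triangleright a$; (4) $a\triangleleft a=a=a\triangleright a$. A morphism of quandles is a map preserving both operations. A subquandle is a subset closed under both operations. A quandle $L$ is free if it has a basis, i.e. a subset $X\subseteq L$ such that every map from $X$ to (the underlying set of) a quandle $R$ extends uniquely to a quandle morphism $L\to R$ (free object in the usual sense of universal algebra; the empty set is allowed as a basis). A concrete model of the free quandle on a set $X$ (a known theorem of Joyce): let $F(X)$ be the free group on $X$, write $a^b=b^{-1}ab$, and let $FQ(X)=\bigcup_{x\in X}\{x^w \mid w\in F(X)\}$ with the operations $h\triangleleft g=g^{h^{-1}}=hgh^{-1}$ and $g\triangleright h=g^h=h^{-1}gh$. Then $FQ(X)$ is a free quandle with basis $X$. *)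

theory Defs
  imports "HOL-Algebra.Congruence"
begin

record 'a quandle = "'a partial_object" +
  ltri :: "'a \<Rightarrow> 'a \<Rightarrow> 'a" (infixl \<open>\<triangleleft>\<index>\<close> 70)
  rtri :: "'a \<Rightarrow> 'a \<Rightarrow> 'a" (infixl \<open>\<triangleright>\<index>\<close> 70)

locale quandle =
  fixes Q :: "'a quandle" (structure)
  assumes ltri_closed: "\<lbrakk>a \<in> carrier Q; b \<in> carrier Q\<rbrakk> \<Longrightarrow> a \<triangleleft> b \<in> carrier Q"
    and rtri_closed: "\<lbrakk>a \<in> carrier Q; b \<in> carrier Q\<rbrakk> \<Longrightarrow> a \<triangleright> b \<in> carrier Q"
    and ltri_distrib: "\<lbrakk>a \<in> carrier Q; b \<in> carrier Q; c \<in> carrier Q\<rbrakk>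
      \<Longrightarrow> a \<triangleleft> (b \<triangleleft> c) = (a \<triangleleft> b) \<triangleleft> (a \<triangleleft> c)"
    and rtri_distrib: "\<lbrakk>a \<in> carrier Q; b \<in> carrier Q; c \<in> carrier Q\<rbrakk>
      \<Longrightarrow> (a \<triangleright> b) \<triangleright> c = (a \<triangleright> c) \<triangleright> (b \<triangleright> c)"
    and ltri_rtri: "\<lbrakk>a \<in> carrier Q; b \<in> carrier Q\<rbrakk> \<Longrightarrow> a \<triangleleft> (b \<triangleright> a) = b"
    and rtri_ltri: "\<lbrakk>a \<in> carrier Q; b \<in> carrier Q\<rbrakk> \<Longrightarrow> (a \<triangleleft> b) \<triangleright> a = b"
    and ltri_idem: "a \<in> carrier Q \<Longrightarrow> a \<triangleleft> a = a"
    and rtri_idem: "a \<in> carrier Q \<Longrightarrow> a \<triangleright> a = a"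

definition quandle_hom :: "'a quandle \<Rightarrow> 'b quandle \<Rightarrow> ('a \<Rightarrow> 'b) set" where
  "quandle_hom L R = {h \<in> carrier L \<rightarrow> carrier R.
     \<forall>a\<in>carrier L. \<forall>b\<in>carrier L.
       h (a \<triangleleft>\<^bsub>L\<^esub> b) = h a \<triangleleft>\<^bsub>R\<^esub> h b \<and> h (a \<triangleright>\<^bsub>L\<^esub> b) = h a \<triangleright>\<^bsub>R\<^esub> h b}"

definition subquandle :: "'a set \<Rightarrow> 'a quandle \<Rightarrow> bool" where
  "subquandle H L \<longleftrightarrow> H \<subseteq> carrier L \<and>
     (\<forall>a\<in>H. \<forall>b\<in>H. a \<triangleleft>\<^bsub>L\<^esub> b \<in> H \<and> a \<triangleright>\<^bsub>L\<^esub> b \<in> H)"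

text \<open>
  HOL functions are total, so uniqueness of a morphism is uniqueness among
  functions that take a fixed dummy value off the carrier (\<open>extensional\<close>).
\<close>

definition extends_uniquely :: "'a quandle \<Rightarrow> 'a set \<Rightarrow> 'b quandle \<Rightarrow> bool" where
  "extends_uniquely L X R \<longleftrightarrow>
     (\<forall>f \<in> X \<rightarrow> carrier R.
        \<exists>!h. h \<in> quandle_hom L R \<inter> extensional (carrier L) \<and> (\<forall>x\<in>X. h x = f x))"

text \<open>
  A definition cannot quantify over all types, so the universal property of a basis
  is stated for the quandles \<open>R\<close> whose elements are taken from the type of quandle terms
  over \<open>'a\<close>. This type is large enough: \<open>quandle_basis_universal\<close> below shows that the
  universal property then holds for quandles over an arbitrary type.
\<close>

datatype 'a qterm = Gen 'a | LTerm "'a qterm" "'a qterm" | RTerm "'a qterm" "'a qterm"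

definition quandle_basis :: "'a quandle \<Rightarrow> 'a set \<Rightarrow> bool" where
  "quandle_basis L X \<longleftrightarrow> X \<subseteq> carrier L \<and>
     (\<forall>R :: 'a qterm quandle. quandle R \<longrightarrow> extends_uniquely L X R)"

definition free_quandle :: "'a quandle \<Rightarrow> bool" where
  "free_quandle L \<longleftrightarrow> quandle L \<and> (\<exists>X. quandle_basis L X)"

lemma subquandle_quandle:
  assumes "quandle L" "subquandle H L"
  shows "quandle (L\<lparr>carrier := H\<rparr>)"
proof -
  interpret L: quandle L by fact
  have H: "H \<subseteq> carrier L" "\<And>a b. \<lbrakk>a \<in> H; b \<in> H\<rbrakk> \<Longrightarrow> a \<triangleleft>\<^bsub>L\<^esub> b \<in> H"
    "\<And>a b. \<lbrakk>a \<in> H; b \<in> H\<rbrakk> \<Longrightarrow> a \<triangleright>\<^bsub>L\<^esub> b \<in> H"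
    using assms(2) unfolding subquandle_def by auto
  show ?thesis
    by (rule quandle.intro; simp add: H)
      (meson H(1) subsetD L.ltri_distrib L.rtri_distrib L.ltri_rtri L.rtri_ltri L.ltri_idem L.rtri_idem)+
qed

inductive_set qgen :: "'a quandle \<Rightarrow> 'a set \<Rightarrow> 'a set" for L X where
  base: "x \<in> X \<Longrightarrow> x \<in> qgen L X"
| left: "a \<in> qgen L X \<Longrightarrow> b \<in> qgen L X \<Longrightarrow> a \<triangleleft>\<^bsub>L\<^esub> b \<in> qgen L X"
| right: "a \<in> qgen L X \<Longrightarrow> b \<in> qgen L X \<Longrightarrow> a \<triangleright>\<^bsub>L\<^esub> b \<in> qgen L X"

lemma qgen_subquandle:
  assumes "quandle L" "X \<subseteq> carrier L"
  shows "subquandle (qgen L X) L"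
proof -
  interpret L: quandle L by fact
  have "a \<in> carrier L" if "a \<in> qgen L X" for a
    using that by induction (use assms(2) L.ltri_closed L.rtri_closed in auto)
  then show ?thesis
    unfolding subquandle_def by (auto intro: qgen.intros)
qed

primrec qeval :: "'b quandle \<Rightarrow> ('a \<Rightarrow> 'b) \<Rightarrow> 'a qterm \<Rightarrow> 'b" where
  "qeval R f (Gen x) = f x"
| "qeval R f (LTerm s t) = qeval R f s \<triangleleft>\<^bsub>R\<^esub> qeval R f t"
| "qeval R f (RTerm s t) = qeval R f s \<triangleright>\<^bsub>R\<^esub> qeval R f t"

lemma qgen_qeval: "b \<in> qgen R (f ` X) \<Longrightarrow> b \<in> range (qeval R f)"
proof (induction rule: qgen.induct)
  case (base b)
  then obtain x where "b = qeval R f (Gen x)"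
    by auto
  then show ?case by blast
next
  case (left a b)
  then obtain s t where "a = qeval R f s" "b = qeval R f t"
    by auto
  then have "a \<triangleleft>\<^bsub>R\<^esub> b = qeval R f (LTerm s t)"
    by simp
  then show ?case by blast
next
  case (right a b)
  then obtain s t where "a = qeval R f s" "b = qeval R f t"
    by auto
  then have "a \<triangleright>\<^bsub>R\<^esub> b = qeval R f (RTerm s t)"
    by simp
  then show ?case by blast
qed

lemma quandle_hom_restrict:
  assumes "quandle L" "h \<in> quandle_hom L R"
  shows "restrict h (carrier L) \<in> quandle_hom L R \<inter> extensional (carrier L)"
proof -
  interpret L: quandle L by fact
  show ?thesis
    using assms(2) L.ltri_closed L.rtri_closed unfolding quandle_hom_def by auto
qed

lemma extends_uniquely_transport:
  fixes R :: "'b quandle" and e :: "'b \<Rightarrow> 'c"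
  assumes L: "quandle L" and R: "quandle R" and X: "X \<subseteq> carrier L"
    and e: "inj_on e (carrier R)"
    and ext: "\<And>R' :: 'c quandle. quandle R' \<Longrightarrow> extends_uniquely L X R'"
  shows "extends_uniquely L X R"
proof -
  interpret R: quandle R by fact
  interpret L: quandle L by fact
  define d where "d = inv_into (carrier R) e"
  have de: "d (e b) = b" if "b \<in> carrier R" for b
    using e that by (simp add: d_def)
  define R' where "R' = \<lparr>carrier = e ` carrier R,
    ltri = (\<lambda>s t. e (d s \<triangleleft>\<^bsub>R\<^esub> d t)), rtri = (\<lambda>s t. e (d s \<triangleright>\<^bsub>R\<^esub> d t))\<rparr>"
  note Rr = R.ltri_closed R.rtri_closed R.ltri_rtri R.rtri_ltri R.ltri_idem R.rtri_idem
  have R': "quandle R'"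
    unfolding R'_def
    by unfold_locales (auto simp: de Rr intro!: arg_cong[of _ _ e] R.ltri_distrib R.rtri_distrib)
  have to: "restrict (\<lambda>a. e (g a)) (carrier L) \<in> quandle_hom L R' \<inter> extensional (carrier L)"
    if "g \<in> quandle_hom L R" for g
    using that L.ltri_closed L.rtri_closed
    unfolding quandle_hom_def R'_def by (auto simp: de Pi_iff)
  have fromR: "restrict (\<lambda>a. d (g a)) (carrier L) \<in> quandle_hom L R \<inter> extensional (carrier L)"
    if "g \<in> quandle_hom L R'" for g
  proof -
    have *: "\<exists>b\<in>carrier R. g a = e b" if "a \<in> carrier L" for a
      using \<open>g \<in> quandle_hom L R'\<close> that unfolding quandle_hom_def R'_def by auto
    have "d (g a) \<in> carrier R" if "a \<in> carrier L" for a
      using *[OF that] de by auto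
    then show ?thesis
      using \<open>g \<in> quandle_hom L R'\<close> L.ltri_closed L.rtri_closed
      unfolding quandle_hom_def R'_def by (auto simp: de Rr)
  qed
  show ?thesis
    unfolding extends_uniquely_def
  proof
    fix f assume f: "f \<in> X \<rightarrow> carrier R"
    have ef: "(\<lambda>x. e (f x)) \<in> X \<rightarrow> carrier R'"
      using f by (auto simp: R'_def)
    have ex1: "\<exists>!h. h \<in> quandle_hom L R' \<inter> extensional (carrier L) \<and> (\<forall>x\<in>X. h x = e (f x))"
      using bspec[OF ext[OF R', unfolded extends_uniquely_def] ef] .
    then obtain h where h: "h \<in> quandle_hom L R'" "\<forall>x\<in>X. h x = e (f x)"
      by blast
    show "\<exists>!h. h \<in> quandle_hom L R \<inter> extensional (carrier L) \<and> (\<forall>x\<in>X. h x = f x)"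
    proof (rule ex_ex1I)
      have "\<forall>x\<in>X. restrict (\<lambda>a. d (h a)) (carrier L) x = f x"
        using h(2) X f de by (auto simp: subset_iff Pi_iff)
      then show "\<exists>h. h \<in> quandle_hom L R \<inter> extensional (carrier L) \<and> (\<forall>x\<in>X. h x = f x)"
        using fromR[OF h(1)] by blast
    next
      fix g1 g2
      assume g1: "g1 \<in> quandle_hom L R \<inter> extensional (carrier L) \<and> (\<forall>x\<in>X. g1 x = f x)"
        and g2: "g2 \<in> quandle_hom L R \<inter> extensional (carrier L) \<and> (\<forall>x\<in>X. g2 x = f x)"
      have "\<forall>x\<in>X. restrict (\<lambda>a. e (g1 a)) (carrier L) x = e (f x)"
        "\<forall>x\<in>X. restrict (\<lambda>a. e (g2 a)) (carrier L) x = e (f x)"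
        using g1 g2 X by auto
      then have eq: "restrict (\<lambda>a. e (g1 a)) (carrier L) = restrict (\<lambda>a. e (g2 a)) (carrier L)"
        using ex1 to[of g1] to[of g2] g1 g2 by blast
      show "g1 = g2"
      proof (rule extensionalityI[where A = "carrier L"])
        fix a assume a: "a \<in> carrier L"
        then have "e (g1 a) = e (g2 a)"
          using fun_cong[OF eq, of a] by simp
        moreover have "g1 a \<in> carrier R" "g2 a \<in> carrier R"
          using a g1 g2 unfolding quandle_hom_def by auto
        ultimately show "g1 a = g2 a"
          using e by (auto dest: inj_onD)
      qed (use g1 g2 in auto)
    qed
  qed
qed

lemma quandle_basis_generates:
  assumes L: "quandle L" and X: "quandle_basis L X"
  shows "carrier L = qgen L X"
proof -
  interpret L: quandle L by fact
  have XL: "X \<subseteq> carrier L"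
    and ext: "\<And>R :: 'a qterm quandle. quandle R \<Longrightarrow> extends_uniquely L X R"
    using X unfolding quandle_basis_def by auto
  have sub: "subquandle (qgen L X) L"
    using qgen_subquandle[OF L XL] .
  define M where "M = L\<lparr>carrier := qgen L X\<rparr>"
  have M: "quandle M"
    unfolding M_def by (rule subquandle_quandle[OF L sub])
  have any: "extends_uniquely L X R" if "quandle R" for R :: "'a quandle"
    by (rule extends_uniquely_transport[OF L that XL _ ext, where e = Gen]) (simp_all add: inj_on_def)
  have "(\<lambda>x. x) \<in> X \<rightarrow> carrier M"
    by (auto simp: M_def intro: qgen.base)
  with any[OF M] obtain h where h: "h \<in> quandle_hom L M" "h \<in> extensional (carrier L)"
      "\<forall>x\<in>X. h x = x"
    unfolding extends_uniquely_def by blast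
  have "h \<in> quandle_hom L L"
    using h(1) sub unfolding quandle_hom_def M_def subquandle_def by auto
  moreover have "restrict (\<lambda>x. x) (carrier L) \<in> quandle_hom L L \<inter> extensional (carrier L)"
    by (rule quandle_hom_restrict[OF L]) (auto simp: quandle_hom_def)
  moreover have "\<forall>x\<in>X. restrict (\<lambda>x. x) (carrier L) x = x"
    using XL by auto
  moreover have incl: "(\<lambda>x. x) \<in> X \<rightarrow> carrier L"
    using XL by auto
  moreover note bspec[OF any[OF L, unfolded extends_uniquely_def] incl]
  ultimately have "h = restrict (\<lambda>x. x) (carrier L)"
    using h by blast
  moreover have "h \<in> carrier L \<rightarrow> qgen L X"
    using h(1) by (simp add: quandle_hom_def M_def)
  ultimately have "a \<in> qgen L X" if "a \<in> carrier L" for a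
    using that by (auto dest: funcset_mem)
  then show ?thesis
    using sub unfolding subquandle_def by auto
qed

theorem quandle_basis_universal:
  fixes L :: "'a quandle" and R :: "'b quandle"
  assumes L: "quandle L" and X: "quandle_basis L X" and R: "quandle R"
  shows "extends_uniquely L X R"
  unfolding extends_uniquely_def
proof
  interpret L: quandle L by fact
  have XL: "X \<subseteq> carrier L"
    and ext: "\<And>R :: 'a qterm quandle. quandle R \<Longrightarrow> extends_uniquely L X R"
    using X unfolding quandle_basis_def by auto
  fix f assume f: "f \<in> X \<rightarrow> carrier R"
  have sub: "subquandle (qgen R (f ` X)) R"
    by (rule qgen_subquandle[OF R]) (use f in auto)
  define S where "S = R\<lparr>carrier := qgen R (f ` X)\<rparr>"
  have S: "quandle S"
    unfolding S_def by (rule subquandle_quandle[OF R sub])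
  have inj: "inj_on (inv_into UNIV (qeval R f)) (carrier S)"
    by (rule inj_on_inv_into) (auto simp: S_def dest: qgen_qeval)
  have "extends_uniquely L X S"
    by (rule extends_uniquely_transport[OF L S XL inj ext])
  moreover have "f \<in> X \<rightarrow> carrier S"
    by (auto simp: S_def intro: qgen.base)
  ultimately obtain h where h: "h \<in> quandle_hom L S" "h \<in> extensional (carrier L)"
      "\<forall>x\<in>X. h x = f x"
    unfolding extends_uniquely_def by blast
  show "\<exists>!h. h \<in> quandle_hom L R \<inter> extensional (carrier L) \<and> (\<forall>x\<in>X. h x = f x)"
  proof (rule ex_ex1I)
    have "h \<in> quandle_hom L R"
      using h(1) sub unfolding quandle_hom_def S_def subquandle_def by auto
    then show "\<exists>h. h \<in> quandle_hom L R \<inter> extensional (carrier L) \<and> (\<forall>x\<in>X. h x = f x)"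
      using h by blast
  next
    fix g1 g2
    assume g1: "g1 \<in> quandle_hom L R \<inter> extensional (carrier L) \<and> (\<forall>x\<in>X. g1 x = f x)"
      and g2: "g2 \<in> quandle_hom L R \<inter> extensional (carrier L) \<and> (\<forall>x\<in>X. g2 x = f x)"
    have gen: "carrier L = qgen L X"
      by (rule quandle_basis_generates[OF L X])
    have "g1 a = g2 a" if "a \<in> qgen L X" for a
      using that
    proof induction
      case (base x)
      then show ?case using g1 g2 by simp
    next
      case (left a b)
      then show ?case using g1 g2 gen by (simp add: quandle_hom_def)
    next
      case (right a b)
      then show ?case using g1 g2 gen by (simp add: quandle_hom_def)
    qed
    then show "g1 = g2"
      using g1 g2 gen by (intro extensionalityI[where A = "carrier L"]) auto
  qed
qed

end

theory Submission
  imports Defs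
begin

text \<open>
  Let \<open>X\<close> be a basis of \<open>L\<close>; words \<open>w\<close> over \<open>X\<^sup>\<plusminus>\<close> act on \<open>L\<close>, and every element
  of \<open>L\<close> has the form \<open>x\<^sup>w\<close>. Let \<open>T\<close> be the set of reduced words \<open>t\<close> having no
  suffix \<open>y\<^sup>\<plusminus>v\<close> with \<open>y\<^sup>v \<in> Q\<close>. The elements \<open>y\<^sup>t \<in> Q\<close> with \<open>t \<in> T\<close> form a basis
  of \<open>Q\<close>. They generate: if \<open>x\<^sup>w \<in> Q\<close> and \<open>w = u y\<^sup>\<plusminus> v\<close> with \<open>y\<^sup>v \<in> Q\<close>, then \<open>x\<^sup>w\<close> arises
  from the shorter elements \<open>x\<^sup>u\<^sup>v\<close> and \<open>y\<^sup>v\<close> of \<open>Q\<close>.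

  For the universal property, \<open>T\<close> is a Schreier transversal for the group generated
  by \<open>Q\<close>: a generator \<open>y\<close> maps \<open>t\<close> to \<open>t\<close> if \<open>y\<^sup>t \<in> Q\<close>, and to the reduction of
  \<open>yt\<close> otherwise. Given a map \<open>f\<close> from the proposed basis to a quandle \<open>R\<close>, this lifts to
  a permutation of \<open>T \<times> R\<close>, acting on the fibre over \<open>t\<close> by \<open>f (y\<^sup>t)\<close> whenever \<open>y\<^sup>t \<in> Q\<close>.
  Freeness of \<open>L\<close> turns this into a morphism from \<open>L\<close> to a quandle of permutations of
  \<open>T \<times> R\<close> with a marked invariant subset, and the marked point over the empty word
  gives the extension of \<open>f\<close> to \<open>Q\<close>.
\<close>

section \<open>Words over a quandle and their action\<close>

context quandle
begin

text \<open>\<open>b \<triangleright> c\<close> is the solution \<open>d\<close> of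
  \<open>c \<triangleleft> d = b\<close>; translating this equation by \<open>a\<close> gives the
  claim.\<close>

lemma ltri_rtri_distrib:
  assumes "a \<in> carrier Q" "b \<in> carrier Q" "c \<in> carrier Q"
  shows "a \<triangleleft> (b \<triangleright> c) = (a \<triangleleft> b) \<triangleright> (a \<triangleleft> c)"
proof -
  have "b = c \<triangleleft> (b \<triangleright> c)"
    using assms by (simp add: ltri_rtri)
  then have "a \<triangleleft> b = (a \<triangleleft> c) \<triangleleft> (a \<triangleleft> (b \<triangleright> c))"
    using assms by (metis ltri_distrib rtri_closed)
  then show ?thesis
    using assms by (simp add: rtri_ltri ltri_closed rtri_closed)
qed

lemma rtri_ltri_distrib:
  assumes "a \<in> carrier Q" "b \<in> carrier Q" "c \<in> carrier Q"
  shows "(a \<triangleleft> b) \<triangleright> c = (a \<triangleright> c) \<triangleleft> (b \<triangleright> c)"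
proof -
  have "b = (a \<triangleleft> b) \<triangleright> a"
    using assms by (simp add: rtri_ltri)
  then have "b \<triangleright> c = ((a \<triangleleft> b) \<triangleright> c) \<triangleright> (a \<triangleright> c)"
    using assms by (metis rtri_distrib ltri_closed)
  then show ?thesis
    using assms by (simp add: ltri_rtri ltri_closed rtri_closed)
qed

text \<open>The letters \<open>(y, True)\<close> and \<open>(y, False)\<close> stand for \<open>y\<close> and \<open>y\<^sup>-\<^sup>1\<close>.\<close>

fun letter_act :: "'a \<Rightarrow> 'a \<times> bool \<Rightarrow> 'a" where
  "letter_act a (y, e) = (if e then a \<triangleright> y else y \<triangleleft> a)"

abbreviation word_act :: "'a \<Rightarrow> ('a \<times> bool) list \<Rightarrow> 'a" where
  "word_act \<equiv> foldl letter_act"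

lemma letter_act_closed:
  "a \<in> carrier Q \<Longrightarrow> fst l \<in> carrier Q \<Longrightarrow> letter_act a l \<in> carrier Q"
  by (cases l) (simp add: ltri_closed rtri_closed)

lemma word_act_closed:
  "a \<in> carrier Q \<Longrightarrow> fst ` set w \<subseteq> carrier Q \<Longrightarrow> word_act a w \<in> carrier Q"
  by (induction w arbitrary: a) (simp_all add: letter_act_closed)

lemma letter_act_cancel:
  "a \<in> carrier Q \<Longrightarrow> y \<in> carrier Q \<Longrightarrow> letter_act (letter_act a (y, e)) (y, \<not> e) = a"
  by (simp add: ltri_rtri rtri_ltri)

lemma letter_act_distrib:
  assumes "a \<in> carrier Q" "b \<in> carrier Q" "fst l \<in> carrier Q"
  shows "letter_act (letter_act a (b, e)) l = letter_act (letter_act a l) (letter_act b l, e)"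
  using assms
  by (cases l) (simp add: ltri_distrib rtri_distrib ltri_rtri_distrib rtri_ltri_distrib)

text \<open>A word acts by automorphisms, so the letter \<open>b\<close> moves past \<open>w\<close>
  and becomes \<open>word_act b w\<close>.\<close>

lemma word_act_distrib:
  assumes "a \<in> carrier Q" "b \<in> carrier Q" "fst ` set w \<subseteq> carrier Q"
  shows "word_act (letter_act a (b, e)) w = letter_act (word_act a w) (word_act b w, e)"
  using assms
proof (induction w arbitrary: a b)
  case (Cons l w)
  then show ?case
    using letter_act_distrib[of a b l e] by (simp add: letter_act_closed del: letter_act.simps)
qed simp

text \<open>The preimage comes from the inverse word: undo the letters of \<open>w\<close> from the
  last one backwards.\<close>

lemma word_act_surj:
  assumes "a \<in> carrier Q" "fst ` set w \<subseteq> carrier Q"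
  shows "\<exists>v. fst ` set v \<subseteq> fst ` set w \<and> word_act (word_act a v) w = a"
  using assms
proof (induction w arbitrary: a rule: rev_induct)
  case (snoc l w)
  obtain y e where l: "l = (y, e)"
    by (cases l)
  have y: "y \<in> carrier Q"
    using snoc.prems l by auto
  obtain v where v: "fst ` set v \<subseteq> fst ` set w"
      "word_act (word_act (letter_act a (y, \<not> e)) v) w = letter_act a (y, \<not> e)"
    using snoc.IH[of "letter_act a (y, \<not> e)"] snoc.prems y letter_act_closed[of a "(y, \<not> e)"]
    by (auto simp del: letter_act.simps)
  have "fst ` set ((y, \<not> e) # v) \<subseteq> fst ` set (w @ [l])"
    "word_act (word_act a ((y, \<not> e) # v)) (w @ [l]) = a"
    using v letter_act_cancel[of a y "\<not> e"] snoc.prems y by (auto simp: l)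
  then show ?case
    by blast
qed simp

text \<open>As in a group, acting by the conjugate \<open>word_act y w\<close> amounts to undoing
  \<open>w\<close>, applying \<open>y\<close> or its inverse, and redoing \<open>w\<close>.\<close>

lemma word_act_letter_act:
  assumes "a \<in> carrier Q" "y \<in> carrier Q" "fst ` set w \<subseteq> carrier Q"
  obtains v where "fst ` set v \<subseteq> insert y (fst ` set w)"
    "letter_act a (word_act y w, e) = word_act a v"
proof -
  obtain v where v: "fst ` set v \<subseteq> fst ` set w" "word_act (word_act a v) w = a"
    using word_act_surj assms by blast
  have "letter_act (word_act (word_act a v) w) (word_act y w, e)
      = word_act (letter_act (word_act a v) (y, e)) w"
    using assms v by (intro word_act_distrib[symmetric] word_act_closed) auto
  then have "letter_act a (word_act y w, e) = word_act a (v @ (y, e) # w)"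
    using v(2) by simp
  moreover have "fst ` set (v @ (y, e) # w) \<subseteq> insert y (fst ` set w)"
    using v(1) by auto
  ultimately show ?thesis
    using that by blast
qed

text \<open>Either operation lets one element act on the other as a letter, and
  \<open>word_act_letter_act\<close> rewrites this as a word over \<open>X\<close>.\<close>

lemma qgen_word_act:
  assumes "X \<subseteq> carrier Q" "a \<in> qgen Q X"
  obtains x w where "x \<in> X" "fst ` set w \<subseteq> X" "a = word_act x w"
proof -
  have step: "\<exists>x\<in>X. \<exists>w. fst ` set w \<subseteq> X \<and> letter_act a (b, e) = word_act x w"
    if a: "\<exists>x\<in>X. \<exists>w. fst ` set w \<subseteq> X \<and> a = word_act x w"
      and b: "\<exists>x\<in>X. \<exists>w. fst ` set w \<subseteq> X \<and> b = word_act x w" for a b e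
  proof -
    obtain x w y v where *: "x \<in> X" "fst ` set w \<subseteq> X" "a = word_act x w"
        "y \<in> X" "fst ` set v \<subseteq> X" "b = word_act y v"
      using a b by blast
    then have "a \<in> carrier Q" "y \<in> carrier Q" "fst ` set v \<subseteq> carrier Q"
      using assms(1) word_act_closed[of x w] subset_trans[OF _ assms(1)] by blast+
    then obtain u where u: "fst ` set u \<subseteq> insert y (fst ` set v)"
        "letter_act a (word_act y v, e) = word_act a u"
      by (rule word_act_letter_act)
    have "letter_act a (b, e) = word_act x (w @ u)"
      using u * by simp
    moreover have "fst ` set (w @ u) \<subseteq> X"
      using u(1) * unfolding set_append image_Un by blast
    ultimately show ?thesis
      using \<open>x \<in> X\<close> by blast
  qed
  have "\<exists>x\<in>X. \<exists>w. fst ` set w \<subseteq> X \<and> a = word_act x w"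
    using assms(2)
  proof induction
    case (base x)
    then show ?case
      by (intro bexI[of _ x] exI[of _ "[]"]) auto
  next
    case (left a b)
    then show ?case
      using step[of b a False] by simp
  next
    case (right a b)
    then show ?case
      using step[of a b True] by simp
  qed
  then show ?thesis
    using that by blast
qed

end

section \<open>Permutations with a marked invariant subset\<close>

lemma quandle_homD:
  assumes "h \<in> quandle_hom L R" "a \<in> carrier L"
  shows "h a \<in> carrier R"
    and "b \<in> carrier L \<Longrightarrow> h (a \<triangleleft>\<^bsub>L\<^esub> b) = h a \<triangleleft>\<^bsub>R\<^esub> h b"
    and "b \<in> carrier L \<Longrightarrow> h (a \<triangleright>\<^bsub>L\<^esub> b) = h a \<triangleright>\<^bsub>R\<^esub> h b"
  using assms unfolding quandle_hom_def by auto

text \<open>Permutations under conjugation; the marks are added because a translation in a quandle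
  need not determine its element. Invariance of \<open>P\<close> under \<open>g\<close> gives
  idempotence.\<close>

definition marked_perm_quandle :: "('z set \<times> ('z \<Rightarrow> 'z)) quandle" where
  "marked_perm_quandle = \<lparr>carrier = {(P, g). bij g \<and> (\<forall>z. g z \<in> P \<longleftrightarrow> z \<in> P)},
     ltri = (\<lambda>(P, g) (P', g'). (inv g -` P', g \<circ> g' \<circ> inv g)),
     rtri = (\<lambda>(P', g') (P, g). (g -` P', inv g \<circ> g' \<circ> g))\<rparr>"

lemma bij_inv_simps:
  assumes "bij g"
  shows "inv g (g z) = z" "g (inv g z) = z" "bij (inv g)" "inv (inv g) = g"
  using assms
  by (simp_all add: bij_is_inj bij_is_surj surj_f_inv_f bij_imp_bij_inv inv_inv_eq)

lemma quandle_marked_perm_quandle: "quandle (marked_perm_quandle :: ('z set \<times> ('z \<Rightarrow> 'z)) quandle)"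
proof -
  have inv: "inv g z \<in> P \<longleftrightarrow> z \<in> P" if "bij g" "\<forall>z. g z \<in> P \<longleftrightarrow> z \<in> P" for g z and P :: "'z set"
    using that by (metis bij_inv_simps(2))
  show ?thesis
    unfolding marked_perm_quandle_def
    by (unfold_locales; clarsimp)
      (simp_all add: set_eq_iff o_inv_distrib bij_comp bij_inv_simps fun_eq_iff inv)
qed

section \<open>The transversal and generation of the subquandle\<close>

locale subquandle_of_generated = quandle L for L :: "'a quandle" (structure) +
  fixes X Q :: "'a set"
  assumes X_carrier: "X \<subseteq> carrier L"
    and generated: "carrier L = qgen L X"
    and subQ: "subquandle Q L"
begin

lemma Q_carrier: "Q \<subseteq> carrier L"
  using subQ by (simp add: subquandle_def)

lemma letter_act_Q: "a \<in> Q \<Longrightarrow> b \<in> Q \<Longrightarrow> letter_act a (b, e) \<in> Q"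
  using subQ by (simp add: subquandle_def)

text \<open>Prepending letters makes the set closed under suffixes, which is the Schreier
  property.\<close>

inductive_set transversal :: "('a \<times> bool) list set" where
  Nil: "[] \<in> transversal"
| Cons: "t \<in> transversal \<Longrightarrow> y \<in> X \<Longrightarrow> word_act y t \<notin> Q \<Longrightarrow> \<not> (\<exists>t'. t = (y, \<not> e) # t')
    \<Longrightarrow> (y, e) # t \<in> transversal"

definition sub_basis :: "'a set" where
  "sub_basis = {a \<in> Q. \<exists>y\<in>X. \<exists>t\<in>transversal. a = word_act y t}"

lemma transversal_letters: "t \<in> transversal \<Longrightarrow> fst ` set t \<subseteq> X"
  by (induction rule: transversal.induct) auto

text \<open>The shortest suffix outside \<open>transversal\<close> has its tail inside, so its first
  letter violates one of the two conditions for prepending.\<close>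

lemma non_transversal:
  assumes "fst ` set w \<subseteq> X" "w \<notin> transversal"
  shows "(\<exists>u y e v. w = u @ (y, e) # v \<and> word_act y v \<in> Q)
    \<or> (\<exists>u y e v. w = u @ (y, e) # (y, \<not> e) # v)"
  using assms
proof (induction w)
  case Nil
  then show ?case
    using transversal.Nil by simp
next
  case (Cons l w)
  show ?case
  proof (cases "w \<in> transversal")
    case True
    obtain y e where l: "l = (y, e)"
      by (cases l)
    have "word_act y w \<in> Q \<or> (\<exists>t'. w = (y, \<not> e) # t')"
      using Cons.prems True l by (auto intro: transversal.Cons)
    then show ?thesis
      using l by (metis append_Nil)
  next
    case False
    then have "(\<exists>u y e v. w = u @ (y, e) # v \<and> word_act y v \<in> Q)
      \<or> (\<exists>u y e v. w = u @ (y, e) # (y, \<not> e) # v)"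
      using Cons by auto
    then show ?thesis
      by (metis append_Cons)
  qed
qed

lemma word_act_in_qgen_sub_basis:
  assumes "x \<in> X" "fst ` set w \<subseteq> X" "word_act x w \<in> Q"
  shows "word_act x w \<in> qgen L sub_basis"
  using assms
proof (induction "length w" arbitrary: x w rule: less_induct)
  case less
  have closed: "word_act z v \<in> carrier L" if "z \<in> X" "fst ` set v \<subseteq> X" for z v
    using that X_carrier by (intro word_act_closed) auto
  show ?case
  proof (cases "w \<in> transversal")
    case True
    then show ?thesis
      using less.prems by (auto simp: sub_basis_def intro!: qgen.base)
  next
    case False
    from non_transversal[OF less.prems(2) this] consider u y e v where "w = u @ (y, e) # v" "word_act y v \<in> Q"
      | u y e v where "w = u @ (y, e) # (y, \<not> e) # v"
      by (elim disjE exE conjE)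
    then show ?thesis
    proof cases
      case 1
      then have y: "y \<in> X" "fst ` set u \<subseteq> X" "fst ` set v \<subseteq> X"
        using less.prems by auto
      then have "y \<in> carrier L" "fst ` set v \<subseteq> carrier L"
        using X_carrier by blast+
      then have eq: "word_act x w = letter_act (word_act x (u @ v)) (word_act y v, e)"
        using 1 y closed[OF less.prems(1), of u] word_act_distrib[of "word_act x u" y v e]
        by simp
      \<comment> \<open>This obtains \<open>word_act x (u @ v)\<close> from two elements of
        \<open>Q\<close>, so it lies in \<open>Q\<close> and the induction hypothesis
        applies.\<close>
      have "letter_act (word_act x w) (word_act y v, \<not> e) = word_act x (u @ v)"
        unfolding eq by (rule letter_act_cancel; rule closed) (use y less.prems in auto)
      then have "word_act x (u @ v) \<in> Q"
        using letter_act_Q[OF less.prems(3) 1(2)] by metis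
      then have "word_act x (u @ v) \<in> qgen L sub_basis"
        by (intro less.hyps) (use 1 y less.prems in auto)
      moreover have "word_act y v \<in> qgen L sub_basis"
        by (rule less.hyps) (use 1 y less.prems in auto)
      ultimately show ?thesis
        unfolding eq by (auto intro: qgen.intros)
    next
      case 2
      have "word_act x u \<in> carrier L" "y \<in> carrier L"
        using 2 X_carrier less.prems by (auto intro!: closed)
      then have "word_act x w = word_act x (u @ v)"
        using letter_act_cancel[of "word_act x u" y e] 2 by simp
      moreover have "word_act x (u @ v) \<in> qgen L sub_basis"
        by (rule less.hyps) (use 2 less.prems calculation in auto)
      ultimately show ?thesis
        by simp
    qed
  qed
qed

lemma Q_eq_qgen: "Q = qgen L sub_basis"
proof
  show "Q \<subseteq> qgen L sub_basis"
  proof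
    fix a assume "a \<in> Q"
    moreover from this have "a \<in> qgen L X"
      using Q_carrier generated by auto
    then obtain x w where "x \<in> X" "fst ` set w \<subseteq> X" "a = word_act x w"
      using qgen_word_act X_carrier by blast
    ultimately show "a \<in> qgen L sub_basis"
      using word_act_in_qgen_sub_basis by blast
  qed
  have "a \<in> Q" if "a \<in> qgen L sub_basis" for a
    using that by induction (use subQ in \<open>auto simp: sub_basis_def subquandle_def\<close>)
  then show "qgen L sub_basis \<subseteq> Q"
    by blast
qed

end

section \<open>Lifting the action to the transversal times a target quandle\<close>

locale subquandle_extension = subquandle_of_generated L X Q + R: quandle R
  for L :: "'a quandle" (structure) and X Q and R :: "'b quandle" +
  fixes f :: "'a \<Rightarrow> 'b"
  assumes f_closed: "f \<in> sub_basis \<rightarrow> carrier R"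
begin

lemma f_transversal:
  "y \<in> X \<Longrightarrow> t \<in> transversal \<Longrightarrow> word_act y t \<in> Q \<Longrightarrow> f (word_act y t) \<in> carrier R"
  using f_closed by (auto simp: sub_basis_def)

text \<open>Identity off \<open>transversal \<times> carrier R\<close>, to obtain a permutation of the whole type.\<close>

fun step :: "'a \<times> bool \<Rightarrow> ('a \<times> bool) list \<times> 'b \<Rightarrow> ('a \<times> bool) list \<times> 'b" where
  "step (y, e) (t, r) =
    (if t \<notin> transversal \<or> r \<notin> carrier R then (t, r)
     else if word_act y t \<in> Q
       then (t, if e then f (word_act y t) \<triangleleft>\<^bsub>R\<^esub> r else r \<triangleright>\<^bsub>R\<^esub> f (word_act y t))
     else if t \<noteq> [] \<and> hd t = (y, \<not> e) then (tl t, r) else ((y, e) # t, r))"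

text \<open>Inside a fibre, opposite letters apply inverse translations; between fibres, one
  prepends the letter that the other removes.\<close>

lemma step_cancel:
  assumes y: "y \<in> X"
  shows "step (y, \<not> e) (step (y, e) (t, r)) = (t, r)"
proof -
  have yc: "y \<in> carrier L"
    using y X_carrier by auto
  \<comment> \<open>By idempotence, prepending a letter of \<open>y\<close> leaves the test of
    \<open>y\<close> against \<open>Q\<close> unchanged, so in the last case the way back removes
    that letter.\<close>
  have fix_y: "word_act y ((y, e) # v) = word_act y v" for e v
    using yc by (simp add: ltri_idem rtri_idem)
  consider "t \<notin> transversal \<or> r \<notin> carrier R"
    | "t \<in> transversal" "r \<in> carrier R" "word_act y t \<in> Q"
    | t' where "t \<in> transversal" "r \<in> carrier R" "word_act y t \<notin> Q" "t = (y, \<not> e) # t'"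
    | "t \<in> transversal" "r \<in> carrier R" "word_act y t \<notin> Q" "\<not> (\<exists>t'. t = (y, \<not> e) # t')"
    by blast
  then show ?thesis
  proof cases
    case 1
    then show ?thesis
      by auto
  next
    case 2
    then show ?thesis
      using f_transversal[OF y]
      by (auto simp: R.ltri_closed R.rtri_closed R.ltri_rtri R.rtri_ltri)
  next
    case (3 t')
    \<comment> \<open>The clause that put \<open>(y, \<not> e)\<close> in front of \<open>t'\<close>
      supplies the conditions for putting it back.\<close>
    have t': "t' \<in> transversal" "word_act y t' \<notin> Q" "\<not> (\<exists>s. t' = (y, e) # s)"
      using 3(1) unfolding 3(4) by (auto elim: transversal.cases)
    have "step (y, e) (t, r) = (t', r)"
      using 3 by simp
    moreover have "step (y, \<not> e) (t', r) = (t, r)"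
      using 3 t' by (cases t') auto
    ultimately show ?thesis
      by simp
  next
    case 4
    have "(y, e) # t \<in> transversal"
      using 4 y by (auto intro: transversal.Cons)
    moreover have "step (y, e) (t, r) = ((y, e) # t, r)"
      using 4 by (cases t rule: list.exhaust) auto
    ultimately show ?thesis
      using 4 fix_y[of e t] by simp
  qed
qed

lemma
  assumes "y \<in> X"
  shows bij_step: "bij (step (y, e))" and inv_step: "inv (step (y, e)) = step (y, \<not> e)"
proof -
  have 1: "step (y, \<not> e) \<circ> step (y, e) = id"
    using step_cancel[OF assms, of e] by (auto simp: fun_eq_iff simp del: step.simps)
  have 2: "step (y, e) \<circ> step (y, \<not> e) = id"
    using step_cancel[OF assms, of "\<not> e"] by (auto simp: fun_eq_iff simp del: step.simps)
  show "bij (step (y, e))"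
    using o_bij[OF 1 2] .
  show "inv (step (y, e)) = step (y, \<not> e)"
    using inv_unique_comp[OF 2 1] .
qed

definition marks :: "'a \<Rightarrow> (('a \<times> bool) list \<times> 'b) set" where
  "marks y = {(t, f (word_act y t)) | t. t \<in> transversal \<and> word_act y t \<in> Q}"

text \<open>Idempotence in \<open>R\<close> fixes every mark, and injectivity keeps other points
  from reaching one.\<close>

lemma step_marks:
  assumes "y \<in> X"
  shows "step (y, True) z \<in> marks y \<longleftrightarrow> z \<in> marks y"
proof -
  have "step (y, True) z = z" if "z \<in> marks y" for z
    using that f_transversal[OF assms] by (auto simp: marks_def R.ltri_idem)
  then show ?thesis
    using bij_is_inj[OF bij_step[OF assms]] by (metis injD)
qed

abbreviation generator_image where
  "generator_image y \<equiv> (marks y, step (y, True))"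

lemma generator_image_closed: "generator_image \<in> X \<rightarrow> carrier marked_perm_quandle"
  by (auto simp: marked_perm_quandle_def bij_step step_marks simp del: step.simps)

abbreviation word_step where
  "word_step w \<equiv> foldr step w"

text \<open>The last letter acts first, so \<open>t\<close> is spelled out along its suffixes; all
  are in \<open>transversal\<close>, so no letter cancels or acts on \<open>r\<close>.\<close>

lemma word_step_transversal:
  assumes "t \<in> transversal" "r \<in> carrier R"
  shows "word_step t ([], r) = (t, r)"
  using assms
proof induction
  case (Cons t y e)
  then show ?case
    by (cases t rule: list.exhaust) auto
qed simp

lemma inj_word_step:
  assumes "fst ` set w \<subseteq> X"
  shows "inj (word_step w)"
  using assms
proof (induction w)
  case (Cons l w)
  then have "inj (step l)"
    using bij_step[of "fst l" "snd l"] bij_is_inj by auto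
  then show ?case
    using Cons inj_compose[of "step l" "word_step w"] by (simp add: comp_def)
qed simp

section \<open>Reading the extension off a morphism to marked permutations\<close>

context
  fixes \<psi>
  assumes hom: "\<psi> \<in> quandle_hom L marked_perm_quandle"
    and gen: "\<And>y. y \<in> X \<Longrightarrow> \<psi> y = generator_image y"
begin

text \<open>The image of \<open>a\<close> gets conjugated by \<open>step (y, e)\<close>; the second
  equation is multiplied through to avoid inverses.\<close>

lemma hom_letter_act:
  assumes "a \<in> carrier L" "y \<in> X"
  shows "z \<in> fst (\<psi> (letter_act a (y, e))) \<longleftrightarrow> step (y, e) z \<in> fst (\<psi> a)"
    and "step (y, e) (snd (\<psi> (letter_act a (y, e))) z) = snd (\<psi> a) (step (y, e) z)"
proof -
  have y: "y \<in> carrier L"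
    using assms X_carrier by auto
  obtain P g where a: "\<psi> a = (P, g)"
    by fastforce
  have *: "\<psi> (letter_act a (y, e))
    = (step (y, e) -` P, step (y, \<not> e) \<circ> g \<circ> step (y, e))"
    using quandle_homD(2)[OF hom y assms(1)] quandle_homD(3)[OF hom assms(1) y]
    by (auto simp: gen assms a marked_perm_quandle_def inv_step simp del: step.simps)
  have cancel: "step (y, e) (step (y, \<not> e) z) = z" for z
    using step_cancel[OF assms(2), of "\<not> e"] by (cases z) simp
  show "z \<in> fst (\<psi> (letter_act a (y, e))) \<longleftrightarrow> step (y, e) z \<in> fst (\<psi> a)"
    unfolding * a by simp
  show "step (y, e) (snd (\<psi> (letter_act a (y, e))) z) = snd (\<psi> a) (step (y, e) z)"
    unfolding * a snd_conv o_apply cancel ..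
qed

lemma hom_word_act:
  assumes "a \<in> carrier L" "fst ` set w \<subseteq> X"
  shows "(z \<in> fst (\<psi> (word_act a w)) \<longleftrightarrow> word_step w z \<in> fst (\<psi> a))
    \<and> word_step w (snd (\<psi> (word_act a w)) z) = snd (\<psi> a) (word_step w z)"
  using assms
proof (induction w arbitrary: a)
  case (Cons l w)
  obtain y e where l: "l = (y, e)"
    by (cases l)
  have y: "y \<in> X"
    using Cons.prems l by auto
  have c: "letter_act a l \<in> carrier L"
    using Cons.prems y X_carrier l by (intro letter_act_closed) auto
  show ?case
    using Cons.IH[OF c] Cons.prems hom_letter_act[OF Cons.prems(1) y, where e = e]
    by (simp add: l del: step.simps letter_act.simps)
qed simp

text \<open>The mark pins down \<open>s\<close>; the translation clause lets the relation pass
  through the operations.\<close>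

definition reads :: "'a \<Rightarrow> 'b \<Rightarrow> bool" where
  "reads a s \<longleftrightarrow> s \<in> carrier R \<and> (\<forall>r\<in>carrier R.
     (([], r) \<in> fst (\<psi> a) \<longleftrightarrow> r = s) \<and> snd (\<psi> a) ([], r) = ([], s \<triangleleft>\<^bsub>R\<^esub> r))"

lemma reads_unique: "reads a s \<Longrightarrow> reads a s' \<Longrightarrow> s = s'"
  by (auto simp: reads_def)

text \<open>For \<open>a = word_act y t\<close>, \<open>word_step t\<close> carries the fibre over
  \<open>[]\<close> to the fibre over \<open>t\<close>, where the image of \<open>y\<close> is
  explicit.\<close>

lemma reads_sub_basis:
  assumes "a \<in> sub_basis"
  shows "reads a (f a)"
proof -
  obtain y t where y: "y \<in> X" "t \<in> transversal" "a = word_act y t" "a \<in> Q"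
    using assms by (auto simp: sub_basis_def)
  have fa: "f a \<in> carrier R"
    using assms f_closed by auto
  have yc: "y \<in> carrier L" and tX: "fst ` set t \<subseteq> X"
    using y X_carrier transversal_letters by auto
  show ?thesis
    unfolding reads_def
  proof (intro conjI ballI fa)
    fix r assume r: "r \<in> carrier R"
    note t = word_step_transversal[OF y(2)]
    note act = hom_word_act[OF yc tX, of "([], r)", folded y(3), unfolded t[OF r] gen[OF y(1)]]
    show "([], r) \<in> fst (\<psi> a) \<longleftrightarrow> r = f a"
      using act y by (auto simp: marks_def)
    have "word_step t (snd (\<psi> a) ([], r)) = word_step t ([], f a \<triangleleft>\<^bsub>R\<^esub> r)"
      using act y r fa t by (simp add: R.ltri_closed)
    then show "snd (\<psi> a) ([], r) = ([], f a \<triangleleft>\<^bsub>R\<^esub> r)"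
      using inj_word_step[OF tX] by (simp add: inj_eq)
  qed
qed

text \<open>By self-distributivity, conjugating one translation of \<open>R\<close> by another gives
  a translation again, and the marks move accordingly.\<close>

lemma reads_ltri_rtri:
  assumes "a \<in> carrier L" "b \<in> carrier L" "reads a s" "reads b s'"
  shows "reads (a \<triangleleft> b) (s \<triangleleft>\<^bsub>R\<^esub> s')" "reads (a \<triangleright> b) (s \<triangleright>\<^bsub>R\<^esub> s')"
proof -
  obtain P g where a: "\<psi> a = (P, g)" by fastforce
  obtain P' g' where b: "\<psi> b = (P', g')" by fastforce
  have bij: "bij g" "bij g'"
    using quandle_homD(1)[OF hom assms(1)] quandle_homD(1)[OF hom assms(2)] a b
    by (auto simp: marked_perm_quandle_def)
  have s: "s \<in> carrier R" "s' \<in> carrier R"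
    and P: "\<And>r. r \<in> carrier R \<Longrightarrow> ([], r) \<in> P \<longleftrightarrow> r = s"
      "\<And>r. r \<in> carrier R \<Longrightarrow> ([], r) \<in> P' \<longleftrightarrow> r = s'"
    and g: "\<And>r. r \<in> carrier R \<Longrightarrow> g ([], r) = ([], s \<triangleleft>\<^bsub>R\<^esub> r)"
      "\<And>r. r \<in> carrier R \<Longrightarrow> g' ([], r) = ([], s' \<triangleleft>\<^bsub>R\<^esub> r)"
    using assms(3,4) by (auto simp: reads_def a b)
  \<comment> \<open>Right translations invert left translations, so the inverses also preserve the
    fibre over \<open>[]\<close>.\<close>
  have ginv: "inv g ([], r) = ([], r \<triangleright>\<^bsub>R\<^esub> s)" "inv g' ([], r) = ([], r \<triangleright>\<^bsub>R\<^esub> s')"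
    if "r \<in> carrier R" for r
    using that bij s g by (auto simp: inv_f_eq bij_is_inj R.rtri_closed R.ltri_rtri)
  have "\<psi> (a \<triangleleft> b) = (inv g -` P', g \<circ> g' \<circ> inv g)"
    using quandle_homD(2)[OF hom assms(1,2)] by (simp add: a b marked_perm_quandle_def)
  moreover have "s \<triangleleft>\<^bsub>R\<^esub> (s' \<triangleleft>\<^bsub>R\<^esub> (r \<triangleright>\<^bsub>R\<^esub> s)) = (s \<triangleleft>\<^bsub>R\<^esub> s') \<triangleleft>\<^bsub>R\<^esub> r" if "r \<in> carrier R" for r
    using that s by (simp add: R.ltri_distrib R.rtri_closed R.ltri_rtri)
  moreover have "r \<triangleright>\<^bsub>R\<^esub> s = s' \<longleftrightarrow> r = s \<triangleleft>\<^bsub>R\<^esub> s'" if "r \<in> carrier R" for r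
    using that s R.ltri_rtri R.rtri_ltri by metis
  ultimately show "reads (a \<triangleleft> b) (s \<triangleleft>\<^bsub>R\<^esub> s')"
    using s by (auto simp: reads_def R.ltri_closed R.rtri_closed g ginv P)
  have "\<psi> (a \<triangleright> b) = (g' -` P, inv g' \<circ> g \<circ> g')"
    using quandle_homD(3)[OF hom assms(1,2)] by (simp add: a b marked_perm_quandle_def)
  moreover have "(s \<triangleleft>\<^bsub>R\<^esub> (s' \<triangleleft>\<^bsub>R\<^esub> r)) \<triangleright>\<^bsub>R\<^esub> s' = (s \<triangleright>\<^bsub>R\<^esub> s') \<triangleleft>\<^bsub>R\<^esub> r" if "r \<in> carrier R" for r
    using that s R.ltri_distrib[of s' "s \<triangleright>\<^bsub>R\<^esub> s'" r] R.rtri_ltri[of s' "(s \<triangleright>\<^bsub>R\<^esub> s') \<triangleleft>\<^bsub>R\<^esub> r"]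
    by (simp add: R.ltri_closed R.rtri_closed R.ltri_rtri)
  moreover have "s' \<triangleleft>\<^bsub>R\<^esub> r = s \<longleftrightarrow> r = s \<triangleright>\<^bsub>R\<^esub> s'" if "r \<in> carrier R" for r
    using that s R.ltri_rtri R.rtri_ltri by metis
  ultimately show "reads (a \<triangleright> b) (s \<triangleright>\<^bsub>R\<^esub> s')"
    using s by (auto simp: reads_def R.ltri_closed R.rtri_closed g ginv P)
qed

text \<open>\<open>reads\<close> holds on the generators, respects the operations and is
  single-valued, so on \<open>Q\<close> it is the graph of a morphism.\<close>

lemma extension_of_hom:
  "\<exists>h. h \<in> quandle_hom (L\<lparr>carrier := Q\<rparr>) R \<and> (\<forall>a\<in>sub_basis. h a = f a)"
proof -
  have ex: "\<exists>s. reads a s" if "a \<in> qgen L sub_basis" for a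
    using that
  proof induction
    case (base a)
    then show ?case
      using reads_sub_basis by blast
  next
    case (left a b)
    then show ?case
      using reads_ltri_rtri(1) Q_carrier Q_eq_qgen by blast
  next
    case (right a b)
    then show ?case
      using reads_ltri_rtri(2) Q_carrier Q_eq_qgen by blast
  qed
  define h where "h a = (THE s. reads a s)" for a
  have h_eq: "h a = s" if "reads a s" for a s
    unfolding h_def using that reads_unique by blast
  have h: "reads a (h a)" if "a \<in> Q" for a
    using ex[of a] that h_eq Q_eq_qgen by auto
  have "h a \<in> carrier R" if "a \<in> Q" for a
    using h[OF that] by (simp add: reads_def)
  moreover have "h (a \<triangleleft> b) = h a \<triangleleft>\<^bsub>R\<^esub> h b \<and> h (a \<triangleright> b) = h a \<triangleright>\<^bsub>R\<^esub> h b"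
    if "a \<in> Q" "b \<in> Q" for a b
    using that Q_carrier h reads_ltri_rtri[of a b "h a" "h b"] h_eq by blast
  ultimately have "h \<in> quandle_hom (L\<lparr>carrier := Q\<rparr>) R"
    by (auto simp: quandle_hom_def)
  then show ?thesis
    using reads_sub_basis h_eq by blast
qed

end

end

section \<open>The basis of the subquandle\<close>

lemma (in subquandle_of_generated) quandle_basis_sub_basis:
  assumes "quandle_basis L X"
  shows "quandle_basis (L\<lparr>carrier := Q\<rparr>) sub_basis"
  unfolding quandle_basis_def
proof (intro conjI allI impI)
  show "sub_basis \<subseteq> carrier (L\<lparr>carrier := Q\<rparr>)"
    by (auto simp: sub_basis_def)
  fix R :: "'a qterm quandle"
  assume R: "quandle R"
  have M: "quandle (L\<lparr>carrier := Q\<rparr>)"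
    using subquandle_quandle[OF quandle_axioms subQ] .
  show "extends_uniquely (L\<lparr>carrier := Q\<rparr>) sub_basis R"
    unfolding extends_uniquely_def
  proof (intro ballI ex_ex1I)
    fix f assume f: "f \<in> sub_basis \<rightarrow> carrier R"
    interpret R: quandle R
      by (rule R)
    interpret subquandle_extension L X Q R f
      by unfold_locales (rule f)
    \<comment> \<open>The marked permutations form a type other than \<open>'a qterm\<close>, hence
      the universal property over arbitrary types.\<close>
    obtain \<psi> where \<psi>: "\<psi> \<in> quandle_hom L marked_perm_quandle" "\<And>y. y \<in> X \<Longrightarrow> \<psi> y = generator_image y"
      using bspec[OF quandle_basis_universal[OF quandle_axioms assms quandle_marked_perm_quandle,
          unfolded extends_uniquely_def] generator_image_closed]
      by (elim ex1E) auto
    obtain h where h: "h \<in> quandle_hom (L\<lparr>carrier := Q\<rparr>) R" "\<forall>a\<in>sub_basis. h a = f a"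
      using extension_of_hom[OF \<psi>] by blast
    have "\<forall>a\<in>sub_basis. restrict h (carrier (L\<lparr>carrier := Q\<rparr>)) a = f a"
      using h(2) by (auto simp: sub_basis_def)
    then show "\<exists>h. h \<in> quandle_hom (L\<lparr>carrier := Q\<rparr>) R \<inter> extensional (carrier (L\<lparr>carrier := Q\<rparr>))
        \<and> (\<forall>a\<in>sub_basis. h a = f a)"
      using quandle_hom_restrict[OF M h(1)] by blast
  next
    fix f h1 h2
    assume h1: "h1 \<in> quandle_hom (L\<lparr>carrier := Q\<rparr>) R \<inter> extensional (carrier (L\<lparr>carrier := Q\<rparr>))
        \<and> (\<forall>a\<in>sub_basis. h1 a = f a)"
      and h2: "h2 \<in> quandle_hom (L\<lparr>carrier := Q\<rparr>) R \<inter> extensional (carrier (L\<lparr>carrier := Q\<rparr>))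
        \<and> (\<forall>a\<in>sub_basis. h2 a = f a)"
    have "h1 a = h2 a" if "a \<in> qgen L sub_basis" for a
      using that
      by induction (use h1 h2 in \<open>simp_all add: quandle_hom_def flip: Q_eq_qgen\<close>)
    then show "h1 = h2"
      using h1 h2 Q_eq_qgen by (intro extensionalityI[where A = Q]) auto
  qed
qed

theorem mainTheorem1:
  fixes L :: "'a quandle" and Q :: "'a set"
  assumes "free_quandle L"
    and "subquandle Q L"
  shows "free_quandle (L\<lparr>carrier := Q\<rparr>)"
proof -
  obtain X where L: "quandle L" and X: "quandle_basis L X"
    using assms(1) by (auto simp: free_quandle_def)
  interpret subquandle_of_generated L X Q
    using L X quandle_basis_generates[OF L X] assms(2)
    by (auto simp: subquandle_of_generated_def subquandle_of_generated_axioms_def quandle_basis_def)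
  show ?thesis
    using quandle_basis_sub_basis[OF X] subquandle_quandle[OF L assms(2)]
    by (auto simp: free_quandle_def)
qed

end
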